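(* Let $y:(1,+\infty)\to(1,+\infty)$ be the unique smooth function satisfying $x^{y(x)}=(y(x))^x$ for all $x>1$ and $y(x)\ne x$ for all $x\neq e$ (so that necessarily $y(e)=e$). Then for every $x\in(1,+\infty)\setminus\{e\}$, $$y(x)>1+\frac{(e-1)^2}{x-1}.$$
   Context: Here $e$ is Euler's number. The function $y$ describes the non-trivial positive solutions of the equation $x^y=y^x$. *)

theory Defs
  imports "HOL-Analysis.Analysis"
begin

text \<open>
  Smoothness of a real function on an open set \<open>S\<close>. Since \<open>S\<close> is open, the
  iterated derivatives at points of \<open>S\<close> depend only on the values of \<open>f\<close> on \<open>S\<close>.
\<close>

definition smooth_on :: "real set \<Rightarrow> (real \<Rightarrow> real) \<Rightarrow> bool" where
  "smooth_on S f \<longleftrightarrow> open S \<and> (\<forall>n. (deriv ^^ n) f differentiable_on S)"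

end

theory Submission
  imports Defs
begin

text \<open>
  The non-trivial solutions of \<open>a\<^sup>b = b\<^sup>a\<close> with \<open>a < b\<close> are parametrised by the ratio \<open>t = b / a > 1\<close>:
  \<open>ln a = ln t / (t - 1)\<close> and \<open>ln b = t ln t / (t - 1)\<close>. Along this curve \<open>(a - 1) (b - 1)\<close> tends to
  \<open>(e - 1)\<^sup>2\<close> as \<open>t \<rightarrow> 1\<close>, so it suffices that it increases with \<open>t\<close>. After replacing \<open>a = exp (ln a)\<close> by
  its quadratic Taylor polynomial, and \<open>ln t\<close> by the bound
  \<open>ln t < (t - 1) (1 + t\<^sup>1\<^sup>/\<^sup>3) / (t + t\<^sup>1\<^sup>/\<^sup>3)\<close>, the sign of the derivative becomes that of a polynomial
  in \<open>t\<^sup>1\<^sup>/\<^sup>3 - 1\<close> with positive coefficients.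
\<close>

text \<open>The two sides agree at \<open>1\<close>, and their difference has derivative \<open>(x -
  1) ^ 4 * (x\<^sup>2 + x + 1) / (x * (x\<^sup>2 + 1))\<^sup>2\<close>. The cube
  \<open>m ^ 3\<close> plays the role of \<open>t\<close>, which keeps the bound rational.\<close>

lemma ln_cube_less:
  fixes m :: real
  assumes "m > 1"
  shows "3 * ln m < (m ^ 3 - 1) * (m + 1) / (m * (m\<^sup>2 + 1))"
proof -
  define f where "f = (\<lambda>m::real. (m ^ 3 - 1) * (m + 1) / (m * (m\<^sup>2 + 1)) - 3 * ln m)"
  have "f 1 < f m"
  proof (rule DERIV_pos_imp_increasing_open[OF assms])
    fix x :: real assume "1 < x" "x < m"
    then have x: "x > 0" "x \<noteq> 0" "x\<^sup>2 + 1 \<noteq> 0" by (auto simp: add_nonneg_eq_0_iff)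
    have x': "x + x * (x * x) \<noteq> 0" using x by (simp add: add_nonneg_eq_0_iff)
    have "(f has_real_derivative
        ((3 * x\<^sup>2 * (x + 1) + (x ^ 3 - 1)) * (x * (x\<^sup>2 + 1))
          - (x ^ 3 - 1) * (x + 1) * (3 * x\<^sup>2 + 1)) / (x * (x\<^sup>2 + 1))\<^sup>2 - 3 / x) (at x)"
      unfolding f_def using x x'
      by (auto intro!: derivative_eq_intros simp: field_simps power2_eq_square power3_eq_cube)
    also have "((3 * x\<^sup>2 * (x + 1) + (x ^ 3 - 1)) * (x * (x\<^sup>2 + 1))
          - (x ^ 3 - 1) * (x + 1) * (3 * x\<^sup>2 + 1)) / (x * (x\<^sup>2 + 1))\<^sup>2 - 3 / x
        = (x - 1) ^ 4 * (x\<^sup>2 + x + 1) / (x * (x\<^sup>2 + 1))\<^sup>2"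
    proof -
      have "3 / x = 3 * x * (x\<^sup>2 + 1)\<^sup>2 / (x * (x\<^sup>2 + 1))\<^sup>2"
        using x by (simp add: power_mult_distrib) (simp add: power2_eq_square)
      show ?thesis
        unfolding \<open>3 / x = _\<close> diff_divide_distrib[symmetric]
        by (intro arg_cong2[where f = "(/)"] refl) algebra
    qed
    finally have "(f has_real_derivative \<dots>) (at x)" .
    moreover have "(x - 1) ^ 4 * (x\<^sup>2 + x + 1) / (x * (x\<^sup>2 + 1))\<^sup>2 > 0"
      using x \<open>1 < x\<close> by (intro divide_pos_pos mult_pos_pos add_pos_pos) auto
    ultimately show "\<exists>y. (f has_real_derivative y) (at x) \<and> 0 < y" by blast
  next
    have "x \<noteq> 0 \<and> x\<^sup>2 + 1 \<noteq> 0" if "x \<in> {1..m}" for x :: real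
      using that by (auto simp: add_nonneg_eq_0_iff)
    then show "continuous_on {1..m} f"
      unfolding f_def by (intro continuous_intros) auto
  qed
  then show ?thesis by (simp add: f_def)
qed

text \<open>Here \<open>z\<close> stands for \<open>t * ln t / (t - 1)\<close>, bounded above
  through \<open>ln_cube_less\<close>. The second expression is \<open>t\<close> times the one in
  \<open>derivative_sign_pos\<close> with \<open>exp (z / t)\<close> cut to its quadratic Taylor
  polynomial. On the allowed range it is smallest at the upper bound \<open>Z\<close>, where it is a
  rational function of \<open>m\<close>.\<close>

lemma derivative_sign_polynomial_pos:
  fixes m z :: real
  assumes m: "m > 1" and z: "1 \<le> z" "z \<le> m\<^sup>2 * (m + 1) / (m\<^sup>2 + 1)"
  defines "t \<equiv> m ^ 3"
  shows "t + 1 - 2 * z > 0"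
    and "(t\<^sup>2 + z * t + z\<^sup>2 / 2) * (t + 1 - 2 * z) - t * (t\<^sup>2 + 1) + t * (t + 1) * z > 0"
proof -
  define w where "w = m\<^sup>2 + 1"
  define Z where "Z = m\<^sup>2 * (m + 1) / w"
  define D where "D = (\<lambda>z. (t\<^sup>2 + z * t + z\<^sup>2 / 2) * (t + 1 - 2 * z) - t * (t\<^sup>2 + 1) + t * (t + 1) * z)"
  have w: "w > 0" by (simp add: w_def add_nonneg_pos)
  have Zw: "Z * w = m\<^sup>2 * (m + 1)" using w by (simp add: Z_def)
  have zZ: "z \<le> Z" using z by (simp add: Z_def w_def)
  have t: "t > 1" using m by (simp add: t_def)
  have "(t + 1 - 2 * Z) * w = (m + 1) * (m - 1) * (m ^ 3 - 1)"
    using Zw unfolding t_def w_def by algebra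
  also have "\<dots> > 0" using m by (intro mult_pos_pos) auto
  finally show "t + 1 - 2 * z > 0"
    using w zZ by (simp add: zero_less_mult_iff)
  define n where "n = m - 1"
  have n: "n > 0" "m = 1 + n" using m by (auto simp: n_def)
  \<comment> \<open>\<open>Z * w\<close> is a polynomial in \<open>m\<close>, so the factor
    \<open>2 * w ^ 3\<close> clears all denominators.\<close>
  have "2 * w ^ 3 * D Z =
      (2 * t\<^sup>2 * w\<^sup>2 + 2 * (Z * w) * t * w + (Z * w)\<^sup>2) * ((t + 1) * w - 2 * (Z * w))
      - 2 * w ^ 3 * t * (t\<^sup>2 + 1) + 2 * t * (t + 1) * (Z * w) * w\<^sup>2"
    unfolding D_def by (simp add: algebra_simps power2_eq_square power3_eq_cube)
  also have "\<dots> = n ^ 3 * (36 + 210 * n + 549 * n\<^sup>2 + 853 * n ^ 3 + 877 * n ^ 4 + 624 * n ^ 5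
      + 309 * n ^ 6 + 103 * n ^ 7 + 21 * n ^ 8 + 2 * n ^ 9)"
    unfolding Zw unfolding t_def w_def n(2) by algebra
  also have "\<dots> > 0" using n by (intro mult_pos_pos add_pos_pos) auto
  finally have DZ: "D Z > 0" using w by (simp add: zero_less_mult_iff)
  have "D z - D Z = (Z - z) * ((3 * t - 1) / 2 * (z + Z) - 2 * t + z\<^sup>2 + z * Z + Z\<^sup>2)"
    unfolding D_def by (simp add: field_simps power2_eq_square)
  also have "\<dots> \<ge> 0"
  proof (rule mult_nonneg_nonneg)
    \<comment> \<open>Since \<open>z\<close> and \<open>Z\<close> are at least 1, this term is at
      least \<open>3 * t - 1\<close>, which outweighs \<open>2 * t\<close>.\<close>
    have "(3 * t - 1) / 2 * (z + Z) \<ge> (3 * t - 1) / 2 * 2"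
      using t z zZ by (intro mult_left_mono) auto
    moreover have "z\<^sup>2 \<ge> 1" "Z\<^sup>2 \<ge> 0" "z * Z \<ge> 0" using z zZ by (auto simp: one_le_power)
    ultimately show "0 \<le> (3 * t - 1) / 2 * (z + Z) - 2 * t + z\<^sup>2 + z * Z + Z\<^sup>2"
      using t by simp
  qed (use zZ in simp)
  finally show "(t\<^sup>2 + z * t + z\<^sup>2 / 2) * (t + 1 - 2 * z) - t * (t\<^sup>2 + 1) + t * (t + 1) * z > 0"
    using DZ by (simp add: D_def)
qed

lemma derivative_sign_pos:
  fixes t :: real
  assumes t: "t > 1"
  defines "z \<equiv> t * ln t / (t - 1)"
  shows "exp (z / t) * t * (t + 1 - 2 * z) - (t\<^sup>2 + 1) + (t + 1) * z > 0"
proof -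
  define m where "m = root 3 t"
  have m: "m > 1" and tm: "t = m ^ 3" using t by (auto simp: m_def)
  have "ln (1 / t) \<le> 1 / t - 1" using t by (intro ln_le_minus_one) auto
  then have z1: "1 \<le> z" using t by (simp add: z_def ln_div field_simps)
  have "ln t < (m ^ 3 - 1) * (m + 1) / (m * (m\<^sup>2 + 1))"
    using ln_cube_less[OF m] m by (simp add: tm ln_realpow)
  then have "z \<le> t / (t - 1) * ((m ^ 3 - 1) * (m + 1) / (m * (m\<^sup>2 + 1)))"
    unfolding z_def times_divide_eq_left[symmetric] using t by (intro mult_left_mono) auto
  also have "\<dots> = m\<^sup>2 * (m + 1) / (m\<^sup>2 + 1)"
  proof -
    have "m ^ 3 - 1 \<noteq> 0" "m ^ 3 = m * m\<^sup>2" "m \<noteq> 0" using t m tm by (auto simp: power2_eq_square power3_eq_cube)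
    then show ?thesis unfolding tm by simp
  qed
  finally have z2: "z \<le> m\<^sup>2 * (m + 1) / (m\<^sup>2 + 1)" .
  note P = derivative_sign_polynomial_pos[OF m z1 z2, folded tm]
  have "z / t \<ge> 0" using z1 t by simp
  then have "1 + z / t + (z / t)\<^sup>2 / 2 \<le> exp (z / t)" by (rule exp_lower_Taylor_quadratic)
  \<comment> \<open>The Taylor bound survives the multiplication because
    \<open>t + 1 - 2 * z\<close> is positive.\<close>
  then have "(1 + z / t + (z / t)\<^sup>2 / 2) * (t\<^sup>2 * (t + 1 - 2 * z)) \<le> exp (z / t) * (t\<^sup>2 * (t + 1 - 2 * z))"
    using P(1) by (intro mult_right_mono) auto
  moreover have "(1 + z / t + (z / t)\<^sup>2 / 2) * (t\<^sup>2 * (t + 1 - 2 * z))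
      = (t\<^sup>2 + z * t + z\<^sup>2 / 2) * (t + 1 - 2 * z)"
    using t by (simp add: field_simps power2_eq_square)
  ultimately have "0 < t * (exp (z / t) * t * (t + 1 - 2 * z) - (t\<^sup>2 + 1) + (t + 1) * z)"
    using P(2) by (simp add: algebra_simps power2_eq_square)
  then show ?thesis using t by (simp add: zero_less_mult_iff)
qed

text \<open>Up to positive factors, the derivative at \<open>x\<close> is the expression of
  \<open>derivative_sign_pos\<close>, with \<open>z\<close> the logarithm of the larger
  solution.\<close>

lemma power_curve_product_increasing:
  fixes s t :: real
  assumes "1 < s" "s < t"
  shows "(exp (ln s / (s - 1)) - 1) * (exp (s * ln s / (s - 1)) - 1)
       < (exp (ln t / (t - 1)) - 1) * (exp (t * ln t / (t - 1)) - 1)"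
proof (rule DERIV_pos_imp_increasing[OF \<open>s < t\<close>,
      where f = "\<lambda>t. (exp (ln t / (t - 1)) - 1) * (exp (t * ln t / (t - 1)) - 1)"])
  fix x assume "s \<le> x" "x \<le> t"
  then have x: "x > 1" using assms by simp
  define a where "a = exp (ln x / (x - 1))"
  define z where "z = x * ln x / (x - 1)"
  have "z = ln x / (x - 1) + ln x" using x by (simp add: z_def field_simps)
  then have b: "exp z = a * x" using x by (simp add: a_def exp_add)
  define d where "d = a * ((x - 1) / x - ln x) / (x - 1)\<^sup>2 * (exp z - 1)
      + (a - 1) * (exp z * ((ln x + 1) * (x - 1) - x * ln x) / (x - 1)\<^sup>2)"
  have "((\<lambda>t. (exp (ln t / (t - 1)) - 1) * (exp (t * ln t / (t - 1)) - 1)) has_real_derivative d) (at x)"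
  proof -
    have q: "((\<lambda>t. ln t / (t - 1)) has_real_derivative ((x - 1) / x - ln x) / (x - 1)\<^sup>2) (at x)"
      using x by (auto intro!: derivative_eq_intros simp: power2_eq_square)
    have z: "((\<lambda>t. t * ln t / (t - 1)) has_real_derivative
        ((ln x + 1) * (x - 1) - x * ln x) / (x - 1)\<^sup>2) (at x)"
      using x by (auto intro!: derivative_eq_intros simp: power2_eq_square)
    show ?thesis
      unfolding d_def a_def z_def
      by (rule DERIV_cong[OF DERIV_mult[OF DERIV_diff[OF DERIV_fun_exp[OF q] DERIV_const]
            DERIV_diff[OF DERIV_fun_exp[OF z] DERIV_const]]]) simp
  qed
  moreover have "d > 0"
  proof -
    have "d * (x * (x - 1)\<^sup>2) = a * ((x - 1 - x * ln x) * (a * x - 1)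
        + (a - 1) * x\<^sup>2 * (x - 1 - ln x))"
    proof -
      \<comment> \<open>Naming the square keeps \<open>field_simps\<close> from expanding
        it.\<close>
      define k where "k = (x - 1)\<^sup>2"
      have "k \<noteq> 0" using x by (simp add: k_def)
      then show ?thesis
        unfolding d_def b k_def[symmetric] using x by (simp add: field_simps power2_eq_square)
    qed
    also have "\<dots> = a * ((x - 1) * (a * x * (x + 1 - 2 * z) - (x\<^sup>2 + 1) + (x + 1) * z))"
    proof -
      \<comment> \<open>This relation eliminates \<open>ln x\<close> in favour of
        \<open>z\<close>.\<close>
      have "z * (x - 1) = x * ln x" using x by (simp add: z_def)
      then show ?thesis by algebra
    qed
    also have "\<dots> > 0"
    proof -
      have "z / x = ln x / (x - 1)" using x by (simp add: z_def)
      then have "a = exp (z / x)" by (simp add: a_def)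
      then show ?thesis using derivative_sign_pos[OF x] x by (simp add: z_def)
    qed
    finally show ?thesis using x by (simp add: zero_less_mult_iff mult_less_0_iff)
  qed
  ultimately show "\<exists>y. ((\<lambda>t. (exp (ln t / (t - 1)) - 1) * (exp (t * ln t / (t - 1)) - 1))
      has_real_derivative y) (at x) \<and> 0 < y" by blast
qed

lemma power_curve_product_gt:
  fixes t :: real
  assumes t: "t > 1"
  shows "(exp (ln t / (t - 1)) - 1) * (exp (t * ln t / (t - 1)) - 1) > (exp 1 - 1)\<^sup>2"
proof -
  define f :: "real \<Rightarrow> real"
    where "f = (\<lambda>t. (exp (ln t / (t - 1)) - 1) * (exp (t * ln t / (t - 1)) - 1))"
  \<comment> \<open>The limit at 1 yields only a weak inequality; passing through an intermediate
    \<open>s\<close> makes it strict.\<close>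
  obtain s where s: "1 < s" "s < t" using dense[OF t] by blast
  \<comment> \<open>This is the difference quotient of \<open>ln\<close> at 1.\<close>
  have "((\<lambda>x::real. ln x / (x - 1)) \<longlongrightarrow> 1) (at 1)"
    using DERIV_ln[of "1::real"] by (simp add: has_field_derivative_iff)
  then have q: "((\<lambda>x::real. ln x / (x - 1)) \<longlongrightarrow> 1) (at_right 1)"
    by (rule filterlim_mono) (auto simp: at_le)
  have "((\<lambda>x::real. x * (ln x / (x - 1))) \<longlongrightarrow> 1 * 1) (at_right 1)"
    by (intro tendsto_mult q tendsto_ident_at)
  then have "(f \<longlongrightarrow> (exp 1 - 1) * (exp 1 - 1)) (at_right 1)"
    unfolding f_def using q by (intro tendsto_intros) auto
  moreover have "\<forall>\<^sub>F x in at_right 1. f x \<le> f s"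
    unfolding eventually_at_right_field
    using s power_curve_product_increasing[of _ s] by (intro exI[of _ s]) (auto simp: f_def less_imp_le)
  ultimately have "(exp 1 - 1) * (exp 1 - 1) \<le> f s"
    by (rule tendsto_upperbound) simp
  also have "f s < f t" using power_curve_product_increasing[OF s] by (simp add: f_def)
  finally show ?thesis by (simp add: f_def power2_eq_square)
qed

lemma powr_commute_product_gt:
  fixes a b :: real
  assumes ab: "1 < a" "a < b" and eq: "a powr b = b powr a"
  shows "(a - 1) * (b - 1) > (exp 1 - 1)\<^sup>2"
proof -
  define t where "t = b / a"
  have t: "t > 1" and b: "b = t * a" using ab by (auto simp: t_def)
  have "b * ln a = a * ln b" using arg_cong[OF eq, of ln] ab by (simp add: ln_powr)
  then have "t * ln a = ln t + ln a" using ab t by (simp add: b ln_mult)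
  then have la: "ln a = ln t / (t - 1)" using t by (simp add: field_simps)
  have "ln b = t * ln t / (t - 1)"
    using la ab t by (simp add: b ln_mult field_simps)
  then have "exp (t * ln t / (t - 1)) = b" "exp (ln t / (t - 1)) = a"
    using la ab by (metis exp_ln less_trans zero_less_one)+
  then show ?thesis using power_curve_product_gt[OF t] by simp
qed

theorem mainTheorem7:
  fixes y :: "real \<Rightarrow> real"
  assumes y_range: "\<And>x. x > 1 \<Longrightarrow> y x > 1"
    and y_smooth: "smooth_on {1<..} y"
    and y_eq: "\<And>x. x > 1 \<Longrightarrow> x powr y x = y x powr x"
    and y_nontrivial: "\<And>x. x > 1 \<Longrightarrow> x \<noteq> exp 1 \<Longrightarrow> y x \<noteq> x"
  shows "\<forall>x \<in> {1<..} - {exp 1}. y x > 1 + (exp 1 - 1)\<^sup>2 / (x - 1)"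
proof
  fix x :: real assume "x \<in> {1<..} - {exp 1}"
  then have x: "x > 1" "y x \<noteq> x" using y_nontrivial by auto
  \<comment> \<open>Equation and product are symmetric in \<open>x\<close> and \<open>y x\<close>,
    so either may be the smaller one.\<close>
  have "(x - 1) * (y x - 1) > (exp 1 - 1)\<^sup>2"
  proof (cases "x < y x")
    case True
    then show ?thesis using powr_commute_product_gt y_eq x by blast
  next
    case False
    then show ?thesis
      using powr_commute_product_gt[of "y x" x] y_eq y_range x by (simp add: mult.commute)
  qed
  then show "y x > 1 + (exp 1 - 1)\<^sup>2 / (x - 1)" using x by (simp add: field_simps)
qed

end
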